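(* For all integers $s\ge 0$, \[ \sum_{n \ge 0} p_s(n) z^n = \frac{1}{1-z} \left( 1 + z \sum_{k \ge 0} z^{2^k}\left( s + \frac{1}{1-z^{2^k}} \right) \right), \] where $p_s(n)$ is the label of the $n$-th leaf of the infinite labelled tree $\mathcal{F}_s$.
   Context: For an integer $s \ge 0$, the infinite tree $\mathcal{F}_s$ is built as follows. It contains an initial single-node tree (one leaf); for each $h \ge 1$ a complete binary tree with $2^h-1$ nodes, called subtree $h$ (so the trees have sizes $1,1,3,7,15,\ldots$); and for each $h\ge 1$ a super-node $y_h$ consisting of $s$ ordinary nodes (no labelled nodes at all if $s=0$). The right child of $y_h$ is the root of subtree $h$; the left child of $y_h$ is $y_{h-1}$ if $h \ge 2$, and is the initial single-node tree if $h=1$. Labels $1,2,3,\ldots$ are given to the nodes in the following order: the initial single node, the $s$ nodes of $y_1$, the nodes of subtree $1$ in preorder, the $s$ nodes of $y_2$, the nodes of subtree $2$ in preorder, and so on. The leaves of $\mathcal{F}_s$ are the initial single node and the leaves of the subtrees $h\ge1$; all other nodes, including those in super-nodes, are internal. For $n\ge 1$, $d_s(n)=1$ if node $n$ is a leaf and $d_s(n)=0$ otherwise; $a_s(n)$ is the number of leaves among nodes $1,\ldots,n$; and $p_s(n)=\min\{j : a_s(j)=n\}$ is the position of the $n$-th $1$ in the sequence $d_s(1),d_s(2),\ldots$. No separate value is specified for $p_s(0)$; the constant term of the right-hand side is $1$. *)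

theory Defs
  imports
    "HOL-Library.Tree"
    "HOL-Computational_Algebra.Formal_Power_Series"
begin

text \<open>
  In the library type of binary trees, \<open>\<langle>\<rangle>\<close> is the empty tree, so a leaf in the usual sense is a
  vertex whose two subtrees are both empty.  A vertex \<open>Sub h p\<close> of subtree \<open>h\<close> is named by the
  path \<open>p\<close> from the root of that subtree to it, where \<open>False\<close> means left and \<open>True\<close> right.
\<close>

datatype vertex = Initial | Super nat | Sub nat "bool list"

fun complete_from :: "nat \<Rightarrow> bool list \<Rightarrow> nat \<Rightarrow> vertex tree" where
  "complete_from h p 0 = \<langle>\<rangle>"
| "complete_from h p (Suc k) =
    \<langle>complete_from h (p @ [False]) k, Sub h p, complete_from h (p @ [True]) k\<rangle>"

definition subtree :: "nat \<Rightarrow> vertex tree" where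
  "subtree h = complete_from h [] h"

text \<open>
  The infinite tree has no root: it is the increasing union of the trees \<open>spine h\<close>, each of which is
  the left subtree of the root \<open>Super (Suc h)\<close> of the next one.
  The parameter \<open>s\<close> does not affect this shape.  It only says how many labelled nodes each
  super-node carries.
\<close>

fun spine :: "nat \<Rightarrow> vertex tree" where
  "spine 0 = \<langle>\<langle>\<rangle>, Initial, \<langle>\<rangle>\<rangle>"
| "spine (Suc h) = \<langle>spine h, Super (Suc h), subtree (Suc h)\<rangle>"

fun leaf_vertices :: "'a tree \<Rightarrow> 'a set" where
  "leaf_vertices \<langle>\<rangle> = {}"
| "leaf_vertices \<langle>l, v, r\<rangle> =
    (if l = \<langle>\<rangle> \<and> r = \<langle>\<rangle> then {v} else leaf_vertices l \<union> leaf_vertices r)"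

definition is_leaf :: "vertex \<Rightarrow> bool" where
  "is_leaf v \<longleftrightarrow> (\<exists>h. v \<in> leaf_vertices (spine h))"

text \<open>
  A labelled node is a pair \<open>(v, i)\<close>, the \<open>i\<close>-th ordinary node of the vertex \<open>v\<close>.  Every vertex
  other than a super-node consists of just one node.
\<close>

fun nodes_of :: "nat \<Rightarrow> vertex \<Rightarrow> (vertex \<times> nat) list" where
  "nodes_of s (Super h) = map (Pair (Super h)) [0..<s]"
| "nodes_of s v = [(v, 0)]"

fun block :: "nat \<Rightarrow> nat \<Rightarrow> (vertex \<times> nat) list" where
  "block s 0 = nodes_of s Initial"
| "block s (Suc h) =
    nodes_of s (Super (Suc h)) @ concat (map (nodes_of s) (preorder (subtree (Suc h))))"

text \<open>
  The node with label \<open>n \<ge> 1\<close>, i.e. the \<open>n\<close>-th entry of the infinite concatenation of all blocks.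
  No block is empty, so the first \<open>n\<close> blocks suffice; the value at \<open>0\<close> is irrelevant.
\<close>

definition node_at :: "nat \<Rightarrow> nat \<Rightarrow> vertex \<times> nat" where
  "node_at s n = concat (map (block s) [0..<n]) ! (n - 1)"

definition leaf_indicator :: "nat \<Rightarrow> nat \<Rightarrow> nat" where
  "leaf_indicator s n = (if is_leaf (fst (node_at s n)) then 1 else 0)"

definition leaf_count :: "nat \<Rightarrow> nat \<Rightarrow> nat" where
  "leaf_count s n = card {j \<in> {1..n}. leaf_indicator s j = 1}"

text \<open>
  There is no zeroth leaf; \<open>leaf_pos s 0 = 1\<close> is a convention, the one which makes the constant
  term of the generating function equal to 1.
\<close>

definition leaf_pos :: "nat \<Rightarrow> nat \<Rightarrow> nat" where
  "leaf_pos s n = (if n = 0 then 1 else (LEAST j. leaf_count s j = n))"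


subsection \<open>Sanity checks\<close>

lemma complete_from_complete:
  "Tree.complete (complete_from h q k) \<and> height (complete_from h q k) = k"
  by (induction h q k rule: complete_from.induct) auto

lemma subtree_complete: "Tree.complete (subtree h)" "size (subtree h) = 2 ^ h - 1"
  using complete_from_complete[of h "[]" h] size_if_complete[of "subtree h"]
  by (auto simp: subtree_def)

lemma is_leaf_iff:
  "is_leaf v \<longleftrightarrow> v = Initial \<or> (\<exists>h\<ge>1. v \<in> leaf_vertices (subtree h))"
proof -
  have ne: "spine h \<noteq> \<langle>\<rangle>" for h by (cases h) auto
  have *: "v \<in> leaf_vertices (spine h) \<longleftrightarrow>
      v = Initial \<or> (\<exists>k\<in>{1..h}. v \<in> leaf_vertices (subtree k))" for h
    by (induction h) (auto simp: ne atLeastAtMostSuc_conv)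
  show ?thesis unfolding is_leaf_def * by force
qed

lemma nodes_of_set: "x \<in> set (nodes_of s v) \<Longrightarrow> fst x = v"
  by (cases v) auto

lemma distinct_nodes_of: "distinct (nodes_of s v)"
  by (cases v) (auto simp: distinct_map inj_on_def)

lemma set_complete_from:
  "v \<in> set_tree (complete_from h q k) \<Longrightarrow> \<exists>r. v = Sub h (q @ r)"
  by (induction h q k rule: complete_from.induct) auto

lemma distinct_complete_from: "distinct (preorder (complete_from h q k))"
proof (induction h q k rule: complete_from.induct)
  case (2 h q k)
  then show ?case by (fastforce dest: set_complete_from)
qed simp

lemma distinct_concat_nodes_of: "distinct vs \<Longrightarrow> distinct (concat (map (nodes_of s) vs))"
  by (induction vs) (auto simp: distinct_nodes_of dest: nodes_of_set)

lemma distinct_block: "distinct (block s h)"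
proof (cases h)
  case (Suc k)
  have "distinct (preorder (subtree h))" by (simp only: subtree_def distinct_complete_from)
  then have "distinct (concat (map (nodes_of s) (preorder (subtree h))))"
    by (rule distinct_concat_nodes_of)
  moreover have "set (nodes_of s (Super h)) \<inter>
      set (concat (map (nodes_of s) (preorder (subtree h)))) = {}"
    by (fastforce simp: subtree_def dest: set_complete_from nodes_of_set)
  ultimately show ?thesis
    using distinct_nodes_of[of s "Super h"] unfolding Suc block.simps distinct_append by blast
qed simp

fun index :: "vertex \<Rightarrow> nat" where
  "index Initial = 0" | "index (Super h) = h" | "index (Sub h q) = h"

lemma index_block: "x \<in> set (block s h) \<Longrightarrow> index (fst x) = h"
  by (cases h) (auto simp: subtree_def dest!: set_complete_from nodes_of_set)

lemma block_nonempty: "block s h \<noteq> []"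
  by (cases h) (auto simp: subtree_def)

lemma length_blocks: "n \<le> length (concat (map (block s) [0..<n]))"
proof (induction n)
  case (Suc n)
  then show ?case using block_nonempty[of s n] by (cases "block s n") auto
qed simp

lemma distinct_blocks: "distinct (concat (map (block s) [0..<n]))"
  by (induction n) (auto simp: distinct_block dest!: index_block)

lemma node_at_eq:
  assumes "1 \<le> n" "n \<le> m"
  shows "node_at s n = concat (map (block s) [0..<m]) ! (n - 1)"
proof -
  have "[0..<m] = [0..<n] @ [n..<m]" using assms upt_add_eq_append[of 0 n "m - n"] by simp
  then show ?thesis
    using length_blocks[of n s] assms by (auto simp: node_at_def nth_append)
qed

lemma set_nodes_blocks:
  "(\<Union>h<Suc m. set (block s h)) = (\<Union>v\<in>set_tree (spine m). set (nodes_of s v))"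
  by (induction m) (auto simp: lessThan_Suc)

text \<open>Labels correspond bijectively to the nodes of the tree.\<close>

lemma bij_betw_node_at:
  "bij_betw (node_at s) {1..} (\<Union>h. \<Union>v\<in>set_tree (spine h). set (nodes_of s v))"
proof -
  let ?L = "\<lambda>n. concat (map (block s) [0..<n])"
  have "inj_on (node_at s) {1..}"
  proof (rule inj_onI)
    fix m n assume mn: "m \<in> {1..}" "n \<in> {1..}" "node_at s m = node_at s n"
    let ?N = "max m n"
    have "?L ?N ! (m - 1) = ?L ?N ! (n - 1)" 
      using mn node_at_eq[of m ?N s] node_at_eq[of n ?N s] by simp
    moreover have "m - 1 < length (?L ?N)" "n - 1 < length (?L ?N)"
      using length_blocks[of ?N s] mn by auto
    ultimately show "m = n" using mn distinct_blocks[of s ?N] by (auto simp: nth_eq_iff_index_eq)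
  qed
  moreover have "node_at s ` {1..} = (\<Union>h. set (block s h))"
  proof (intro equalityI subsetI)
    fix x assume "x \<in> node_at s ` {1..}"
    then obtain n where "n \<ge> 1" "x = ?L n ! (n - 1)" by (auto simp: node_at_def)
    moreover from this have "n - 1 < length (?L n)" using length_blocks[of n s] by linarith
    ultimately have "x \<in> set (?L n)" using nth_mem by blast
    then show "x \<in> (\<Union>h. set (block s h))" by auto
  next
    fix x assume "x \<in> (\<Union>h. set (block s h))"
    then obtain h where "x \<in> set (?L (Suc h))" by auto
    then obtain i where i: "i < length (?L (Suc h))" "x = ?L (Suc h) ! i"
      by (metis in_set_conv_nth)
    let ?N = "max (Suc i) (Suc h)"
    have "[0..<?N] = [0..<Suc h] @ [Suc h..<?N]"
      using upt_add_eq_append[of 0 "Suc h" "?N - Suc h"] by simp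
    then have "?L ?N ! i = x" using i by (simp add: nth_append del: upt_Suc)
    then have "node_at s (Suc i) = x" using node_at_eq[of "Suc i" ?N s] by simp
    then show "x \<in> node_at s ` {1..}" by force
  qed
  moreover have "(\<Union>h. set (block s h)) = (\<Union>h. \<Union>v\<in>set_tree (spine h). set (nodes_of s v))"
    unfolding set_nodes_blocks[symmetric] by blast
  ultimately show ?thesis by (simp add: bij_betw_def)
qed

text \<open>The infinite sum in the generating function converges.\<close>

lemma summable_gf:
  "summable (\<lambda>k. fps_X ^ (2 ^ k) * (of_nat s + 1 / (1 - fps_X ^ (2 ^ k))) :: rat fps)"
proof -
  define f :: "nat \<Rightarrow> rat fps" where
    "f k = fps_X ^ (2 ^ k) * (of_nat s + 1 / (1 - fps_X ^ (2 ^ k)))" for k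
  have z: "fps_nth (f k) n = 0" if "n < k" for k n
    using less_trans[OF that less_exp[of k]] by (simp add: f_def fps_X_power_mult_nth)
  have "(\<lambda>m. \<Sum>k<m. f k) \<longlonglongrightarrow> Abs_fps (\<lambda>n. \<Sum>k\<le>n. fps_nth (f k) n)"
  proof (rule tendsto_fpsI)
    fix n
    show "\<forall>\<^sub>F m in sequentially. fps_nth (\<Sum>k<m. f k) n = fps_nth (Abs_fps (\<lambda>n. \<Sum>k\<le>n. fps_nth (f k) n)) n"
    proof (rule eventually_sequentiallyI[of "Suc n"])
      fix m assume "Suc n \<le> m"
      then show "fps_nth (\<Sum>k<m. f k) n = fps_nth (Abs_fps (\<lambda>n. \<Sum>k\<le>n. fps_nth (f k) n)) n"
        by (auto simp: fps_sum_nth intro!: sum.mono_neutral_right) (use z not_le in blast)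
    qed
  qed
  then have "summable f" unfolding summable_def sums_def by blast
  then show ?thesis unfolding f_def .
qed

end

theory Submission
  imports Defs
begin

text \<open>
  Reading the nodes of the tree in label order and recording for each whether it is a leaf gives
  a word over the booleans.  Cut it after every \<open>True\<close>.  In preorder, a complete binary tree with
  \<open>2 ^ k\<close> leaves yields the pieces whose numbers of \<open>False\<close> are the 2-adic valuations of
  \<open>2 ^ k, \<dots>, 2 ^ (k + 1) - 1\<close> (the ruler sequence), so that the trees fit together to the ruler
  sequence on all positive integers.  The super-nodes insert \<open>s\<close> further entries before the
  pieces numbered by powers of two.  Hence the gap between the leaves \<open>n\<close> and \<open>n + 1\<close> is
  \<open>1 + multiplicity 2 n\<close>, which is the number of \<open>k\<close> with \<open>2 ^ k dvd n\<close>, plus \<open>s\<close> if \<open>n\<close> is a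
  power of two.  This is the coefficient of \<open>z ^ n\<close> in the infinite sum.
\<close>

subsection \<open>The leaf word\<close>

definition ruler :: "nat \<Rightarrow> bool list" where
  "ruler n = replicate (multiplicity 2 n) False @ [True]"

text \<open>Since \<open>multiplicity 2 0 = 0\<close> and 0 is not a power of two,
  \<open>gap s 0\<close> is \<open>[True]\<close>, the piece of the initial node. So piece
  \<open>n\<close> ends with leaf \<open>n + 1\<close>.\<close>

definition gap :: "nat \<Rightarrow> nat \<Rightarrow> bool list" where
  "gap s n = (if \<exists>k. n = 2 ^ k then replicate s False else []) @ ruler n"

lemma multiplicity_two_power_add:
  fixes j :: nat
  assumes "0 < j" "\<not> 2 ^ a dvd j"
  shows "multiplicity 2 (j + 2 ^ a) = multiplicity 2 j"
proof -
  have "multiplicity 2 j < a"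
    using assms by (simp add: power_dvd_iff_le_multiplicity)
  then show ?thesis
    using assms by (intro multiplicity_sum_lt) simp_all
qed

lemma concat_ruler_shift:
  assumes "\<And>j. m \<le> j \<Longrightarrow> j < n \<Longrightarrow> 0 < j \<and> \<not> 2 ^ a dvd j"
  shows "concat (map ruler [2 ^ a + m..<2 ^ a + n]) = concat (map ruler [m..<n])"
proof -
  have "[2 ^ a + m..<2 ^ a + n] = map (\<lambda>j. j + 2 ^ a) [m..<n]"
    by (rule nth_equalityI) auto
  moreover have "map ruler (map (\<lambda>j. j + 2 ^ a) [m..<n]) = map ruler [m..<n]"
    using assms by (auto simp: ruler_def multiplicity_two_power_add)
  ultimately show ?thesis by (simp only:)
qed

text \<open>This mirrors preorder: root, left subtree, right subtree. The valuation of
  \<open>2 ^ Suc k\<close> exceeds that of \<open>2 ^ k\<close> by one, and the extra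
  \<open>False\<close> is the root.\<close>

lemma concat_ruler_double:
  "concat (map ruler [2 ^ Suc k..<2 ^ Suc (Suc k)]) =
    False # concat (map ruler [2 ^ k..<2 ^ Suc k]) @ concat (map ruler [2 ^ k..<2 ^ Suc k])"
proof -
  let ?R = "\<lambda>m n. concat (map ruler [m..<n])"
  have split: "?R l n = ?R l m @ ?R m n" if "l \<le> m" "m \<le> n" for l m n
    using that upt_add_eq_append[of l m "n - m"] by simp
  have head: "?R (2 ^ a) n = replicate a False @ True # ?R (Suc (2 ^ a)) n" if "2 ^ a < n" for a n
    using that by (simp add: upt_conv_Cons ruler_def)
  \<comment> \<open>Shifting by \<open>2 ^ k\<close> keeps the valuations strictly between the two
    powers; the endpoint \<open>2 ^ k\<close> is left out because its valuation rises to
    \<open>Suc k\<close>.\<close>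
  have mid: "?R (Suc (2 ^ Suc k)) (2 ^ Suc k + 2 ^ k) = ?R (Suc (2 ^ k)) (2 ^ Suc k)"
  proof -
    have "0 < j \<and> \<not> 2 ^ k dvd j" if "Suc (2 ^ k) \<le> j" "j < 2 ^ Suc k" for j :: nat
    proof -
      have "j - 2 ^ k < 2 ^ k" "0 < j - 2 ^ k" using that by auto
      then have "\<not> 2 ^ k dvd j - 2 ^ k" using nat_dvd_not_less by blast
      then show ?thesis using that by (auto simp: dvd_minus_self)
    qed
    from concat_ruler_shift[of "Suc (2 ^ k)" "2 ^ Suc k" k, OF this] have
      s1: "?R (2 ^ k + Suc (2 ^ k)) (2 ^ k + 2 ^ Suc k) = ?R (Suc (2 ^ k)) (2 ^ Suc k)" .
    have "2 ^ k + Suc (2 ^ k) = Suc (2 ^ Suc k)" "2 ^ k + 2 ^ Suc k = 2 ^ Suc k + (2::nat) ^ k"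
      by simp_all
    with s1 show ?thesis by metis
  qed
  \<comment> \<open>Shifting by \<open>2 ^ Suc k\<close> instead keeps the valuation of
    \<open>2 ^ k\<close> too.\<close>
  have top: "?R (2 ^ Suc k + 2 ^ k) (2 ^ Suc k + 2 ^ Suc k) = ?R (2 ^ k) (2 ^ Suc k)"
  proof (rule concat_ruler_shift)
    fix j :: nat assume "2 ^ k \<le> j" "j < 2 ^ Suc k"
    moreover have "(0::nat) < 2 ^ k" by simp
    ultimately show "0 < j \<and> \<not> 2 ^ Suc k dvd j" using nat_dvd_not_less by force
  qed
  have "?R (2 ^ Suc k) (2 ^ Suc (Suc k)) =
      ?R (2 ^ Suc k) (2 ^ Suc k + 2 ^ k) @ ?R (2 ^ Suc k + 2 ^ k) (2 ^ Suc k + 2 ^ Suc k)"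
    using split[of "2 ^ Suc k" "2 ^ Suc k + 2 ^ k" "2 ^ Suc k + 2 ^ Suc k"]
    by (simp add: mult_2)
  also have "?R (2 ^ Suc k) (2 ^ Suc k + 2 ^ k) = False # ?R (2 ^ k) (2 ^ Suc k)"
    using head[of "Suc k" "2 ^ Suc k + 2 ^ k"] head[of k "2 ^ Suc k"] mid by simp
  finally show ?thesis unfolding top by simp
qed

lemma leaf_vertices_complete_from:
  "v \<in> leaf_vertices (complete_from h p (Suc k)) \<longleftrightarrow> (\<exists>q. length q = k \<and> v = Sub h (p @ q))"
proof (induction k arbitrary: p)
  case (Suc k)
  have "(\<exists>q. length q = Suc k \<and> v = Sub h (p @ q)) \<longleftrightarrow>
      (\<exists>q. length q = k \<and> v = Sub h (p @ False # q)) \<or>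
      (\<exists>q. length q = k \<and> v = Sub h (p @ True # q))"
    by (auto simp: length_Suc_conv)
  then show ?case
    using Suc.IH[of "p @ [False]"] Suc.IH[of "p @ [True]"] by simp
qed auto

lemma is_leaf_Sub: "is_leaf (Sub h q) \<longleftrightarrow> Suc (length q) = h"
proof -
  have "is_leaf (Sub h q) \<longleftrightarrow> (\<exists>k. Sub h q \<in> leaf_vertices (complete_from (Suc k) [] (Suc k)))"
    unfolding is_leaf_iff subtree_def
    by (metis One_nat_def Suc_le_D Suc_le_mono le0 vertex.distinct(3))
  then show ?thesis unfolding leaf_vertices_complete_from by auto
qed

lemma is_leaf_Initial: "is_leaf Initial"
  by (simp add: is_leaf_iff)

lemma not_is_leaf_Super: "\<not> is_leaf (Super h)"
proof
  assume "is_leaf (Super h)"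
  then obtain k where "Super h \<in> leaf_vertices (complete_from (Suc k) [] (Suc k))"
    unfolding is_leaf_iff subtree_def by (metis One_nat_def Suc_le_D vertex.distinct(1))
  then show False unfolding leaf_vertices_complete_from by simp
qed

text \<open>\<open>h\<close> stays fixed while \<open>p\<close> grows in the induction. The
  assumption says that the part below \<open>p\<close> reaches the bottom level of subtree
  \<open>h\<close>, where its leaves lie.\<close>

lemma leaf_word_complete_from:
  assumes "h = length p + Suc k"
  shows "map (is_leaf \<circ> fst) (concat (map (nodes_of s) (preorder (complete_from h p (Suc k))))) =
    concat (map ruler [2 ^ k..<2 ^ Suc k])"
  using assms
proof (induction k arbitrary: p)
  case 0
  then show ?case by (simp add: is_leaf_Sub ruler_def upt_conv_Cons)
next
  case (Suc k)
  show ?case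
    unfolding concat_ruler_double complete_from.simps(2)[of h p "Suc k"]
    using Suc.IH[of "p @ [False]"] Suc.IH[of "p @ [True]"] Suc.prems
    by (simp add: is_leaf_Sub del: upt_Suc complete_from.simps(2))
qed

text \<open>The only power of two in the dyadic interval is its first element, so the
  \<open>s\<close> extra entries come first, just as the super-node precedes its subtree.\<close>

lemma leaf_word_block:
  "map (is_leaf \<circ> fst) (block s (Suc h)) = concat (map (gap s) [2 ^ h..<2 ^ Suc h])"
proof -
  have "gap s n = ruler n" if "Suc (2 ^ h) \<le> n" "n < 2 ^ Suc h" for n
  proof -
    have "n \<noteq> 2 ^ k" for k
    proof
      assume "n = 2 ^ k"
      with that have "(2::nat) ^ h < 2 ^ k" "(2::nat) ^ k < 2 ^ Suc h" by linarith+
      then have "h < k" "k < Suc h"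
        by (simp_all only: power_strict_increasing_iff one_less_numeral_iff semiring_norm)
      then show False by simp
    qed
    then show ?thesis by (simp add: gap_def)
  qed
  then have "map (gap s) [Suc (2 ^ h)..<2 ^ Suc h] = map ruler [Suc (2 ^ h)..<2 ^ Suc h]"
    by simp
  moreover have "[2 ^ h..<2 ^ Suc h] = 2 ^ h # [Suc (2 ^ h)..<2 ^ Suc h]"
    by (simp add: upt_conv_Cons)
  moreover have "gap s (2 ^ h) = replicate s False @ ruler (2 ^ h)"
    by (auto simp: gap_def)
  ultimately have "concat (map (gap s) [2 ^ h..<2 ^ Suc h]) =
      replicate s False @ concat (map ruler [2 ^ h..<2 ^ Suc h])"
    by (simp only: list.map concat.simps append_assoc)
  moreover have "map (is_leaf \<circ> fst) (nodes_of s (Super (Suc h))) = replicate s False"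
    by (simp add: not_is_leaf_Super comp_def map_replicate_const)
  ultimately show ?thesis
    using leaf_word_complete_from[of "Suc h" "[]" h s] by (simp add: subtree_def)
qed

lemma leaf_word_blocks:
  "map (is_leaf \<circ> fst) (concat (map (block s) [0..<Suc h])) = concat (map (gap s) [0..<2 ^ h])"
proof (induction h)
  case 0
  then show ?case by (simp add: is_leaf_Initial gap_def ruler_def)
next
  case (Suc h)
  have "[0..<2 ^ Suc h] = [0..<2 ^ h] @ [2 ^ h..<2 ^ Suc h]"
    using upt_add_eq_append[of 0 "2 ^ h" "2 ^ h"] by (simp add: mult_2)
  moreover have "map (is_leaf \<circ> fst) (concat (map (block s) [0..<Suc (Suc h)])) =
      map (is_leaf \<circ> fst) (concat (map (block s) [0..<Suc h])) @
      map (is_leaf \<circ> fst) (block s (Suc h))"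
    by simp
  ultimately show ?case
    by (simp only: Suc.IH leaf_word_block map_append concat_append)
qed


subsection \<open>Positions of the leaves\<close>

text \<open>\<open>node_at\<close> reads each label off a different list; a common bound
  \<open>m\<close> allows counting in a single one.\<close>

lemma leaf_count_eq:
  assumes "n \<le> m"
  shows "leaf_count s n =
    length (filter id (take n (map (is_leaf \<circ> fst) (concat (map (block s) [0..<m])))))"
proof -
  let ?L = "concat (map (block s) [0..<m])"
  have len: "n \<le> length ?L" using length_blocks[of m s] assms by linarith
  have ind: "leaf_indicator s (Suc i) = 1 \<longleftrightarrow> is_leaf (fst (?L ! i))" if "i < n" for i
    using that assms by (simp add: leaf_indicator_def node_at_eq[of "Suc i" m s])
  have "{j \<in> {1..n}. leaf_indicator s j = 1} = Suc ` {i. i < n \<and> leaf_indicator s (Suc i) = 1}"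
    using image_Suc_lessThan[of n] by auto
  also have "\<dots> = Suc ` {i. i < n \<and> is_leaf (fst (?L ! i))}"
    using ind by (metis (mono_tags, lifting))
  finally have "{j \<in> {1..n}. leaf_indicator s j = 1} = Suc ` {i. i < n \<and> is_leaf (fst (?L ! i))}" .
  then have "leaf_count s n = card {i. i < n \<and> is_leaf (fst (?L ! i))}"
    by (simp add: leaf_count_def card_image)
  also have "\<dots> = card {i. i < length (take n (map (is_leaf \<circ> fst) ?L)) \<and>
      id (take n (map (is_leaf \<circ> fst) ?L) ! i)}"
    using len by (intro arg_cong[of _ _ card]) auto
  finally show ?thesis by (simp only: length_filter_conv_card)
qed

lemma leaf_count_mono: "i \<le> j \<Longrightarrow> leaf_count s i \<le> leaf_count s j"
  unfolding leaf_count_def by (intro card_mono) auto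

lemma leaf_count_prefix:
  assumes "concat (map (gap s) [0..<n]) = xs @ ys"
  shows "leaf_count s (length xs) = length (filter id xs)"
proof -
  \<comment> \<open>Two bounds are needed: \<open>n < 2 ^ h\<close> makes \<open>xs\<close> a prefix
    of the leaf word, and \<open>length xs \<le> Suc h\<close> makes \<open>leaf_count_eq\<close>
    applicable.\<close>
  define h where "h = max n (length xs)"
  have "n \<le> h" by (simp add: h_def)
  also have "h < 2 ^ h" by simp
  finally have "n < 2 ^ h" .
  then have "[0..<2 ^ h] = [0..<n] @ [n..<2 ^ h]"
    using upt_add_eq_append[of 0 n "2 ^ h - n"] by simp
  then have "take (length xs) (concat (map (gap s) [0..<2 ^ h])) = xs"
    using assms by simp
  then show ?thesis
    using leaf_count_eq[of "length xs" "Suc h" s] unfolding leaf_word_blocks by (simp add: h_def)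
qed

lemma filter_concat_gap: "length (filter id (concat (map (gap s) [0..<n]))) = n"
  by (induction n) (auto simp: gap_def ruler_def)

lemma leaf_pos_Suc: "leaf_pos s (Suc n) = length (concat (map (gap s) [0..<Suc n]))"
proof -
  let ?w = "concat (map (gap s) [0..<Suc n])"
  have "?w = butlast ?w @ [True]" by (simp add: gap_def ruler_def butlast_append)
  then obtain u where u: "?w = u @ [True]" by blast
  have last: "leaf_count s (length ?w) = Suc n"
    using leaf_count_prefix[of s "Suc n" ?w "[]"] filter_concat_gap[of s "Suc n"] by simp
  \<comment> \<open>Without its final \<open>True\<close> the word has one leaf fewer, so by
    monotonicity no earlier position reaches \<open>Suc n\<close>.\<close>
  have "leaf_count s (length u) = n"
    using leaf_count_prefix[OF u] filter_concat_gap[of s "Suc n"] unfolding u by simp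
  then have "length ?w \<le> j" if "leaf_count s j = Suc n" for j
    using leaf_count_mono[of j "length u" s] that unfolding u by force
  with last have "(LEAST j. leaf_count s j = Suc n) = length ?w"
    by (rule Least_equality)
  then show ?thesis by (simp add: leaf_pos_def)
qed

lemma leaf_pos_step:
  "leaf_pos s (Suc n) = leaf_pos s n +
    (if n = 0 then 0 else (if \<exists>k. n = 2 ^ k then s else 0) + Suc (multiplicity 2 n))"
proof (cases n)
  \<comment> \<open>The convention \<open>leaf_pos s 0 = 1\<close> equals the position of the first
    leaf, so the increment is 0.\<close>
  case 0
  then show ?thesis by (simp add: leaf_pos_Suc gap_def ruler_def) (simp add: leaf_pos_def)
next
  case (Suc m)
  then have "leaf_pos s (Suc n) = leaf_pos s n + length (gap s n)"
    by (simp add: leaf_pos_Suc)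
  then show ?thesis using Suc by (simp add: gap_def ruler_def)
qed


subsection \<open>The generating function\<close>

text \<open>Terms with \<open>k > n\<close> do not affect coefficient \<open>n\<close>, so it is
  constant along the partial sums from \<open>Suc n\<close> on.\<close>

lemma fps_nth_suminf:
  fixes f :: "nat \<Rightarrow> 'a::ring_1 fps"
  assumes z: "\<And>k n. n < k \<Longrightarrow> fps_nth (f k) n = 0"
  shows "fps_nth (suminf f) n = (\<Sum>k\<le>n. fps_nth (f k) n)"
proof -
  have "(\<lambda>m. \<Sum>k<m. f k) \<longlonglongrightarrow> Abs_fps (\<lambda>n. \<Sum>k\<le>n. fps_nth (f k) n)"
  proof (rule tendsto_fpsI)
    fix n
    show "\<forall>\<^sub>F m in sequentially.
      fps_nth (\<Sum>k<m. f k) n = fps_nth (Abs_fps (\<lambda>n. \<Sum>k\<le>n. fps_nth (f k) n)) n"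
    proof (rule eventually_sequentiallyI[of "Suc n"])
      fix m assume "Suc n \<le> m"
      then show "fps_nth (\<Sum>k<m. f k) n = fps_nth (Abs_fps (\<lambda>n. \<Sum>k\<le>n. fps_nth (f k) n)) n"
        by (auto simp: fps_sum_nth intro!: sum.mono_neutral_right) (use z not_le in blast)
    qed
  qed
  then have "suminf f = Abs_fps (\<lambda>n. \<Sum>k\<le>n. fps_nth (f k) n)"
    by (intro sums_unique[symmetric]) (simp add: sums_def)
  then show ?thesis by simp
qed

lemma geometric_fps_X_power:
  assumes "0 < m"
  shows "1 / (1 - fps_X ^ m) = (Abs_fps (\<lambda>n. if m dvd n then 1 else 0) :: 'a::field fps)"
proof -
  let ?G = "Abs_fps (\<lambda>n. if m dvd n then 1 else 0) :: 'a fps"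
  have "?G * (1 - fps_X ^ m) = 1"
  proof (rule fps_ext)
    fix n
    show "fps_nth (?G * (1 - fps_X ^ m)) n = fps_nth 1 n"
      using assms nat_dvd_not_less[of n m]
      by (auto simp: algebra_simps fps_X_power_mult_nth dvd_minus_self)
  qed
  moreover from this have "1 - fps_X ^ m \<noteq> (0 :: 'a fps)" by force
  ultimately show ?thesis by (metis nonzero_mult_div_cancel_right)
qed

text \<open>The condition \<open>0 < n\<close> appears because the factor
  \<open>fps_X ^ (2 ^ k)\<close> removes the constant term of the geometric series.\<close>

lemma nth_summand:
  "fps_nth (fps_X ^ (2 ^ k) * (of_nat s + 1 / (1 - fps_X ^ (2 ^ k))) :: 'a::field fps) n =
    (if n = 2 ^ k then of_nat s else 0) + (if 0 < n \<and> 2 ^ k dvd n then 1 else 0)"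
proof -
  have "n < 2 ^ k \<Longrightarrow> \<not> (0 < n \<and> 2 ^ k dvd n)" using nat_dvd_not_less by blast
  then show ?thesis
    by (auto simp: geometric_fps_X_power fps_X_power_mult_nth fps_of_nat[symmetric] dvd_minus_self)
qed

lemma nth_suminf_summand:
  "fps_nth (\<Sum>k. fps_X ^ (2 ^ k) * (of_nat s + 1 / (1 - fps_X ^ (2 ^ k))) :: 'a::field fps) n =
    of_nat (if n = 0 then 0 else (if \<exists>k. n = 2 ^ k then s else 0) + Suc (multiplicity 2 n))"
proof -
  have z: "fps_nth (fps_X ^ (2 ^ k) * (of_nat s + 1 / (1 - fps_X ^ (2 ^ k))) :: 'a fps) n = 0"
    if "n < k" for k n
    using less_trans[OF that less_exp[of k]] by (simp add: fps_X_power_mult_nth)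
  have powers: "(\<Sum>k\<le>n. if n = 2 ^ k then of_nat s else 0) =
      (if \<exists>k. n = 2 ^ k then of_nat s else (0::'a))"
  proof (cases "\<exists>k. n = 2 ^ k")
    case True
    then obtain j where j: "n = 2 ^ j" by blast
    then have "(\<Sum>k\<le>n. if n = 2 ^ k then of_nat s else 0) =
        (\<Sum>k\<le>n. if k = j then of_nat s else (0::'a))"
      by (intro sum.cong) auto
    also have "\<dots> = of_nat s" using j less_exp[of j] by (simp add: less_imp_le)
    finally show ?thesis using True by simp
  qed simp
  have divs: "(\<Sum>k\<le>n. if 0 < n \<and> 2 ^ k dvd n then 1 else 0) =
      (of_nat (if n = 0 then 0 else Suc (multiplicity 2 n)) :: 'a)"
  proof (cases "n = 0")
    case False
    have "2 ^ multiplicity 2 n \<le> n" using False by (intro dvd_imp_le multiplicity_dvd) auto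
    \<comment> \<open>Cutting the sum off at \<open>k = n\<close> thus loses none of the exponents 0
      to \<open>multiplicity 2 n\<close>.\<close>
    then have "multiplicity 2 n \<le> n" using less_exp[of "multiplicity 2 n"] by linarith
    then have "{..n} \<inter> {k. 2 ^ k dvd n} = {..multiplicity 2 n}"
      using False by (auto simp: power_dvd_iff_le_multiplicity)
    then show ?thesis using False by (simp add: sum.If_cases)
  qed simp
  show ?thesis
    by (simp only: fps_nth_suminf[OF z] nth_summand sum.distrib powers divs) auto
qed

theorem lemma2p15:
  fixes s :: nat
  shows "Abs_fps (\<lambda>n. of_nat (leaf_pos s n)) =
    (1 / (1 - fps_X)) *
      (1 + fps_X * (\<Sum>k. fps_X ^ (2 ^ k) * (of_nat s + 1 / (1 - fps_X ^ (2 ^ k)))) :: rat fps)"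
    (is "?P = (1 / (1 - fps_X)) * (1 + fps_X * ?S)")
proof -
  \<comment> \<open>Multiplying by \<open>1 - fps_X\<close> turns positions into gaps; the factor
    \<open>fps_X\<close> on the right matches gap \<open>m\<close> with coefficient
    \<open>Suc m\<close>.\<close>
  have "?P * (1 - fps_X) = 1 + fps_X * ?S"
  proof (rule fps_ext)
    fix n
    show "fps_nth (?P * (1 - fps_X)) n = fps_nth (1 + fps_X * ?S) n"
    proof (cases n)
      case 0
      then show ?thesis by (simp add: leaf_pos_def)
    next
      case (Suc m)
      then show ?thesis
        by (simp add: right_diff_distrib nth_suminf_summand leaf_pos_step[of s m])
    qed
  qed
  moreover have "1 - fps_X \<noteq> (0 :: rat fps)"
    by (metis diff_0_right fps_X_neq_one right_minus_eq)
  ultimately have "?P = (1 + fps_X * ?S) / (1 - fps_X)"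
    by (metis nonzero_mult_div_cancel_right)
  then show ?thesis by (simp add: fps_divide_unit)
qed

end
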